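(* For every $n\geq 2$, $\mathrm{MEG}(Q_n)=2^n$, where $Q_n$ is the hypercube of dimension $n$.
   Context: $Q_n$ has vertex set $\{0,1\}^n$ (equivalently labels $0,\dots,2^n-1$ in binary), with two vertices adjacent iff their binary representations differ in exactly one bit. Two vertices $x,y$ of a graph $G$ monitor an edge $e$ if $e$ belongs to all shortest paths between $x$ and $y$. A set $S\subseteq V(G)$ is a monitoring edge-geodetic set (MEG-set) if for every edge $e$ of $G$ there is a pair $x,y\in S$ that monitors $e$. $\mathrm{MEG}(G)$ denotes the minimum size of an MEG-set of $G$. *)

theory Defs
  imports "Graph_Theory.Graph_Theory"
begin

text \<open>
  An undirected simple graph is a symmetric loop-free pair digraph (locale \<^locale>\<open>pair_graph\<close>);
  the undirected edge \<open>{u, v}\<close> stands for the two arcs \<open>(u, v)\<close> and \<open>(v, u)\<close>.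
\<close>

definition undirected :: "('a \<times> 'a) set \<Rightarrow> 'a set set" where
  "undirected A = {{u, v} | u v. (u, v) \<in> A}"

definition edges :: "'a pair_pre_digraph \<Rightarrow> 'a set set" where
  "edges G = undirected (parcs G)"

definition path_edges :: "'a vwalk \<Rightarrow> 'a set set" where
  "path_edges p = undirected (set (vwalk_arcs p))"

definition path_between :: "'a pair_pre_digraph \<Rightarrow> 'a \<Rightarrow> 'a vwalk \<Rightarrow> 'a \<Rightarrow> bool" where
  "path_between G x p y \<longleftrightarrow> vpath p (with_proj G) \<and> hd p = x \<and> last p = y"

definition shortest_path :: "'a pair_pre_digraph \<Rightarrow> 'a \<Rightarrow> 'a vwalk \<Rightarrow> 'a \<Rightarrow> bool" where
  "shortest_path G x p y \<longleftrightarrow>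
     path_between G x p y \<and> (\<forall>q. path_between G x q y \<longrightarrow> vwalk_length p \<le> vwalk_length q)"

text \<open>
  The first conjunct only excludes the vacuous case of two vertices in different components;
  it is automatic in a connected graph.
\<close>

definition monitor :: "'a pair_pre_digraph \<Rightarrow> 'a \<Rightarrow> 'a \<Rightarrow> 'a set \<Rightarrow> bool" where
  "monitor G x y e \<longleftrightarrow>
     (\<exists>p. shortest_path G x p y) \<and> (\<forall>p. shortest_path G x p y \<longrightarrow> e \<in> path_edges p)"

definition MEG_set :: "'a pair_pre_digraph \<Rightarrow> 'a set \<Rightarrow> bool" where
  "MEG_set G S \<longleftrightarrow> S \<subseteq> pverts G \<and> (\<forall>e\<in>edges G. \<exists>x\<in>S. \<exists>y\<in>S. monitor G x y e)"

definition MEG :: "'a pair_pre_digraph \<Rightarrow> nat" where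
  "MEG G = (LEAST k. \<exists>S. finite S \<and> MEG_set G S \<and> card S = k)"

definition hypercube :: "nat \<Rightarrow> bool list pair_pre_digraph" where
  "hypercube n =
     \<lparr> pverts = {x. length x = n},
       parcs = {(x, y). length x = n \<and> length y = n \<and> card {i. i < n \<and> x ! i \<noteq> y ! i} = 1} \<rparr>"

lemma pair_graph_hypercube: "pair_graph (hypercube n)"
proof
  have fin: "finite {x :: bool list. length x = n}"
    using finite_lists_length_eq[of "UNIV :: bool set" n] by simp
  then show "finite (pverts (hypercube n))" by (simp add: hypercube_def)
  show "finite (parcs (hypercube n))"
    by (rule finite_subset[OF _ finite_cartesian_product[OF fin fin]]) (auto simp: hypercube_def)
  show "symmetric (with_proj (hypercube n))"
    unfolding symmetric_def
  proof (rule symI)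
    fix x y assume "(x, y) \<in> arcs_ends (with_proj (hypercube n))"
    then have len: "length y = n" "length x = n" and card: "card {i. i < n \<and> x ! i \<noteq> y ! i} = 1"
      by (simp_all add: hypercube_def)
    have "{i. i < n \<and> x ! i \<noteq> y ! i} = {i. i < n \<and> y ! i \<noteq> x ! i}" by auto
    note card[unfolded this]
    with len show "(y, x) \<in> arcs_ends (with_proj (hypercube n))"
      by (simp add: hypercube_def)
  qed
next
  fix e assume e: "e \<in> parcs (hypercube n)"
  then show "fst e \<in> pverts (hypercube n)" "snd e \<in> pverts (hypercube n)"
    by (simp_all add: hypercube_def split_beta)
  have card: "card {i. i < n \<and> fst e ! i \<noteq> snd e ! i} = 1"
    using e by (simp add: hypercube_def split_beta)
  show "fst e \<noteq> snd e"
  proof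
    assume eq: "fst e = snd e"
    show False using card unfolding eq by simp
  qed
qed

text \<open>The set of all vertices is an MEG-set, so the minimum in \<^const>\<open>MEG\<close> is attained.\<close>

lemma (in pair_graph) MEG_set_pverts: "MEG_set G (pverts G)"
  unfolding MEG_set_def
proof (intro conjI ballI)
  fix e assume "e \<in> edges G"
  then obtain u v where e: "e = {u, v}" and uv: "(u, v) \<in> parcs G"
    by (auto simp: edges_def undirected_def)
  have ne: "u \<noteq> v" using pair_no_loops[OF uv] by simp
  have V: "u \<in> pverts G" "v \<in> pverts G" using uv wellformed' by auto
  have pb: "path_between G u [u, v] v"
    using uv ne V by (auto simp: path_between_def vpath_def vwalk_def)
  have len: "2 \<le> length q" if "path_between G u q v" for q
  proof (rule ccontr)
    assume "\<not> 2 \<le> length q"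
    moreover have "q \<noteq> []" using that by (simp add: path_between_def vpath_def vwalk_def)
    ultimately have "length q = Suc 0" by (simp add: le_Suc_eq not_le less_Suc_eq numeral_2_eq_2)
    then obtain w where "q = [w]" by (auto simp: length_Suc_conv)
    then show False using that ne by (auto simp: path_between_def)
  qed
  have sp: "shortest_path G u [u, v] v"
    unfolding shortest_path_def
  proof (intro conjI allI impI)
    fix q assume "path_between G u q v"
    then show "vwalk_length [u, v] \<le> vwalk_length q" using len[of q] by simp
  qed (rule pb)
  have "e \<in> path_edges p" if "shortest_path G u p v" for p
  proof -
    have p: "path_between G u p v" and "vwalk_length p \<le> vwalk_length [u, v]"
      using that pb unfolding shortest_path_def by blast+
    then have "length p = 2" using len[OF p] by simp
    then have "p = [u, v]" using p
      by (auto simp: path_between_def length_Suc_conv numeral_2_eq_2)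
    then show ?thesis by (auto simp: e path_edges_def undirected_def)
  qed
  then show "\<exists>x\<in>pverts G. \<exists>y\<in>pverts G. monitor G x y e"
    using sp V unfolding monitor_def by blast
qed simp

end

theory Submission
  imports Defs
begin

text \<open>
  In the hypercube every path \<open>a, b, c\<close> of length two with \<open>a \<noteq> c\<close> can be rerouted through the
  other common neighbour of \<open>a\<close> and \<open>c\<close>. Hence an inner vertex of a shortest path can be avoided
  by another shortest path with the same ends, and so can every edge at that vertex: a pair can
  only monitor the edge that joins it. As every vertex lies on some edge, the only MEG-set is the
  whole vertex set.
\<close>

text \<open>Cutting loops out of a walk only deletes vertices. This lets a rerouted shortest path,
  which is a priori just a walk, be turned back into a path without gaining length.\<close>

lemma length_vwalk_to_vpath_le: "length (vwalk_to_vpath p) \<le> length p"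
proof (induct p rule: vwalk_to_vpath_induct3)
  case (in_set x xs)
  then show ?case
    using length_dropWhile_le[of "\<lambda>y. y \<noteq> x" xs] by simp
qed simp_all

text \<open>Keeping \<open>v\<close> in both halves preserves the arcs on either side of the
  cut.\<close>

lemma set_vwalk_arcs_split:
  "set (vwalk_arcs (p @ v # q)) = set (vwalk_arcs (p @ [v])) \<union> set (vwalk_arcs (v # q))"
  by (induct p rule: vwalk_arcs.induct) auto

lemma in_set_vwalk_arcs_decomp:
  assumes "(u, v) \<in> set (vwalk_arcs p)"
  obtains r s where "p = r @ u # v # s"
proof -
  from assms have "\<exists>r s. p = r @ u # v # s"
  proof (induct p rule: vwalk_arcs.induct)
    case (3 x y xs)
    show ?case
    proof (cases "(u, v) = (x, y)")
      case True
      then have "x # y # xs = [] @ u # v # xs" by simp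
      then show ?thesis by blast
    next
      case False
      with 3 obtain r s where "y # xs = r @ u # v # s" by auto
      then have "x # y # xs = (x # r) @ u # v # s" by simp
      then show ?thesis by blast
    qed
  qed simp_all
  with that show thesis by blast
qed

context pair_wf_digraph
begin

text \<open>Replacing \<open>b\<close> by \<open>b'\<close> keeps the length. Whether
  \<open>b'\<close> already occurs on the path is left open: loops are simply cut out, and
  minimality of the original path makes the result shortest.\<close>

lemma shortest_path_avoiding:
  assumes p: "shortest_path G x (r @ a # b # c # s) y"
    and arcs: "(a, b') \<in> parcs G" "(b', c) \<in> parcs G" and ne: "b' \<noteq> b"
  obtains q where "shortest_path G x q y" "b \<notin> set q"
proof
  let ?p = "r @ a # b # c # s" and ?w = "r @ a # b' # c # s"
  let ?q = "vwalk_to_vpath ?w"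
  have walk: "vwalk ?p (with_proj G)" and dist: "distinct ?p"
    and ends: "hd ?p = x" "last ?p = y"
    and min: "\<And>q. path_between G x q y \<Longrightarrow> vwalk_length ?p \<le> vwalk_length q"
    using p unfolding shortest_path_def path_between_def vpath_def by blast+
  have "vwalk ?w (with_proj G)"
    \<comment> \<open>Split at \<open>a\<close>, the two walks share the arcs up to \<open>a\<close>
      and from \<open>c\<close> on; only the two arcs at \<open>b'\<close> are new.\<close>
    using walk arcs wellformed'[OF arcs(1)]
    by (auto simp: vwalk_def set_vwalk_arcs_split[of r a "b # c # s"]
        set_vwalk_arcs_split[of r a "b' # c # s"])
  then have "vpath ?q (with_proj G)" by (rule vwalk_to_vpath_vpath)
  moreover have "hd ?q = x"
    unfolding vwalk_to_vpath_hd ends(1)[symmetric] by (cases r) simp_all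
  moreover have "last ?q = y"
    unfolding vwalk_to_vpath_last ends(2)[symmetric] by simp
  ultimately have "path_between G x ?q y" unfolding path_between_def by blast
  moreover have "vwalk_length ?q \<le> vwalk_length ?p"
    using length_vwalk_to_vpath_le[of ?w] by simp
  ultimately show "shortest_path G x ?q y"
    unfolding shortest_path_def using min le_trans by blast
  show "b \<notin> set ?q"
    \<comment> \<open>By distinctness \<open>b\<close> occurred only at the replaced position, and
      cutting loops adds no vertex.\<close>
    using dist ne by (auto dest: vwalk_to_vpath_subset)
qed

lemma monitor_eq_endpoints:
  assumes reroute: "\<And>a b c. (a, b) \<in> parcs G \<Longrightarrow> (b, c) \<in> parcs G \<Longrightarrow> a \<noteq> c \<Longrightarrow>
      \<exists>b'. b' \<noteq> b \<and> (a, b') \<in> parcs G \<and> (b', c) \<in> parcs G"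
    and mon: "monitor G x y e"
  shows "e = {x, y}"
proof -
  obtain p where p: "shortest_path G x p y" and "e \<in> path_edges p"
    using mon unfolding monitor_def by blast
  then obtain u v where e: "e = {u, v}" and "(u, v) \<in> set (vwalk_arcs p)"
    by (auto simp: path_edges_def undirected_def)
  then obtain r s where rs: "p = r @ u # v # s"
    by (auto elim: in_set_vwalk_arcs_decomp)
  have no_inner: "b \<notin> e" if dec: "p = r @ a # b # c # s" for r a b c s
  proof
    assume "b \<in> e"
    \<comment> \<open>Here \<open>a \<noteq> c\<close> holds because the vertices of a path are
      distinct.\<close>
    have "(a, b) \<in> parcs G" "(b, c) \<in> parcs G" "a \<noteq> c"
      using p unfolding dec
      by (auto simp: shortest_path_def path_between_def vpath_def vwalk_def
          set_vwalk_arcs_split[of r a "b # c # s"])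
    from reroute[OF this] obtain b' where "b' \<noteq> b" "(a, b') \<in> parcs G" "(b', c) \<in> parcs G"
      by blast
    then obtain q where q: "shortest_path G x q y" and "b \<notin> set q"
      using shortest_path_avoiding p unfolding dec by metis
    have "e \<in> path_edges q" using mon q unfolding monitor_def by blast
    then have "e \<subseteq> set q"
      by (auto simp: path_edges_def undirected_def elim: in_set_vwalk_arcsE)
    with \<open>b \<in> e\<close> \<open>b \<notin> set q\<close> show False by blast
  qed
  \<comment> \<open>A nonempty \<open>s\<close> would make \<open>v\<close> an inner vertex of
    \<open>p\<close>, and likewise a nonempty \<open>r\<close> would make \<open>u\<close> one; both
    lie on \<open>e\<close>.\<close>
  have "s = []"
  proof (cases s)
    case (Cons c s')
    then show ?thesis using no_inner[of r u v c s'] rs e by simp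
  qed
  moreover have "r = []"
  proof (cases r rule: rev_cases)
    case (snoc r' a)
    then show ?thesis using no_inner[of r' a u v s] rs e by simp
  qed
  ultimately show ?thesis
    using p e rs by (auto simp: shortest_path_def path_between_def)
qed

end

text \<open>A singleton set of differing positions is the same as one flipped bit; in this form
  neighbours can be written down explicitly.\<close>

lemma arc_hypercube_iff:
  "(x, y) \<in> parcs (hypercube n) \<longleftrightarrow> length x = n \<and> (\<exists>i<n. y = x[i := \<not> x ! i])"
proof
  assume "(x, y) \<in> parcs (hypercube n)"
  then have len: "length x = n" "length y = n" and "card {i. i < n \<and> x ! i \<noteq> y ! i} = 1"
    by (auto simp: hypercube_def)
  then obtain i where i: "{i. i < n \<and> x ! i \<noteq> y ! i} = {i}"
    by (auto simp: card_1_singleton_iff)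
  then have "i < n" "x ! i \<noteq> y ! i" by blast+
  moreover have "y ! j = x ! j" if "j < n" "j \<noteq> i" for j
    using i that by blast
  ultimately have "y = x[i := \<not> x ! i]"
    using len by (auto intro!: nth_equalityI simp: nth_list_update split: if_splits)
  with len \<open>i < n\<close> show "length x = n \<and> (\<exists>i<n. y = x[i := \<not> x ! i])" by blast
next
  assume "length x = n \<and> (\<exists>i<n. y = x[i := \<not> x ! i])"
  then obtain i where len: "length x = n" and i: "i < n" "y = x[i := \<not> x ! i]" by blast
  then have "{j. j < n \<and> x ! j \<noteq> y ! j} = {i}"
    by (auto simp: nth_list_update split: if_splits)
  with len i show "(x, y) \<in> parcs (hypercube n)"
    by (simp add: hypercube_def)
qed

text \<open>Flips of two different bits commute, so performing them in the opposite order gives the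
  other midpoint.\<close>

lemma hypercube_reroute:
  assumes "(a, b) \<in> parcs (hypercube n)" "(b, c) \<in> parcs (hypercube n)" "a \<noteq> c"
  shows "\<exists>b'. b' \<noteq> b \<and> (a, b') \<in> parcs (hypercube n) \<and> (b', c) \<in> parcs (hypercube n)"
proof -
  obtain i j where len: "length a = n" and i: "i < n" "b = a[i := \<not> a ! i]"
    and j: "j < n" "c = b[j := \<not> b ! j]"
    using assms(1,2) unfolding arc_hypercube_iff by blast
  \<comment> \<open>Flipping the same bit twice would lead back to \<open>a\<close>.\<close>
  have ij: "i \<noteq> j"
    using assms(3) len i j by auto
  let ?b' = "a[j := \<not> a ! j]"
  have "?b' \<noteq> b"
  proof
    assume "?b' = b"
    \<comment> \<open>Bit \<open>i\<close> is flipped in \<open>b\<close> but still that of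
      \<open>a\<close> in \<open>?b'\<close>.\<close>
    then have "?b' ! i = b ! i" by simp
    then show False using ij i len by simp
  qed
  moreover have "(a, ?b') \<in> parcs (hypercube n)"
    using len j unfolding arc_hypercube_iff by blast
  moreover have "c = ?b'[i := \<not> ?b' ! i]"
    using ij i j by (simp add: list_update_swap)
  then have "(?b', c) \<in> parcs (hypercube n)"
    using len i unfolding arc_hypercube_iff by auto
  ultimately show ?thesis by blast
qed

text \<open>Since \<open>n \<ge> 1\<close>, each vertex has an edge that flips bit 0; only the ends
  of that edge can monitor it, which forces the vertex into \<open>S\<close>.\<close>

lemma MEG_set_hypercube_iff:
  assumes "n \<ge> 1"
  shows "MEG_set (hypercube n) S \<longleftrightarrow> S = pverts (hypercube n)"
proof
  interpret pair_graph "hypercube n" by (rule pair_graph_hypercube)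
  show "MEG_set (hypercube n) S" if "S = pverts (hypercube n)"
    using that MEG_set_pverts by simp
  assume S: "MEG_set (hypercube n) S"
  have "x \<in> S" if "x \<in> pverts (hypercube n)" for x
  proof -
    let ?y = "x[0 := \<not> x ! 0]"
    have "(x, ?y) \<in> parcs (hypercube n)"
      using that assms unfolding arc_hypercube_iff by (auto simp: hypercube_def intro!: exI[of _ 0])
    then have "{x, ?y} \<in> edges (hypercube n)"
      by (auto simp: edges_def undirected_def)
    then obtain u v where uv: "u \<in> S" "v \<in> S" "monitor (hypercube n) u v {x, ?y}"
      using S unfolding MEG_set_def by blast
    have "{x, ?y} = {u, v}"
      by (rule monitor_eq_endpoints[OF hypercube_reroute uv(3)])
    with uv show "x \<in> S" by (auto simp: doubleton_eq_iff)
  qed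
  moreover have "S \<subseteq> pverts (hypercube n)" using S unfolding MEG_set_def by blast
  ultimately show "S = pverts (hypercube n)" by blast
qed

theorem theorem6:
  fixes n :: nat
  assumes "n \<ge> 2"
  shows "MEG (hypercube n) = 2 ^ n"
proof -
  interpret pair_graph "hypercube n" by (rule pair_graph_hypercube)
  have "card (pverts (hypercube n)) = 2 ^ n"
    using card_lists_length_eq[of "UNIV :: bool set" n] by (simp add: hypercube_def)
  \<comment> \<open>With a unique MEG-set, only one size is attained, so the minimum is
    immediate.\<close>
  then have "(\<exists>S. finite S \<and> MEG_set (hypercube n) S \<and> card S = k) \<longleftrightarrow> k = 2 ^ n" for k
    using assms pair_finite_verts by (auto simp: MEG_set_hypercube_iff)
  then show ?thesis
    unfolding MEG_def by (auto intro: Least_equality)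
qed

end
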